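(* Let $k\ge1$ be an integer, let $\mathcal{P}_k$ be the class of $k$-polymatroids, and let $\mathcal{P}\subseteq\mathcal{P}_k$ be a minor-closed subclass. Then there exists a unique map $U:\mathcal{P}\to\mathbb{Z}[x,y,a,b]$ such that for every $P\in\mathcal{P}$ and every $e\in E(P)$, $$U(P)=\begin{cases}1,&\text{if }P=\emptyset,\\ a^{k-\Delta(e)}x^{\Delta(e)}\,U(P\setminus e)+b^{k-m(e)}y^{m(e)}\,U(P/e),&\text{otherwise,}\end{cases}$$ where $\Delta(e)=r(P)-r(P\setminus e)$ and $m(e)=k-r(e)$. Moreover, for $P=(E,r)\in\mathcal{P}$, $$U(P;x,y,a,b)=a^{k|E|-r(P)}\,b^{r(P)}\,T_k\!\left(P;\frac{x+b}{b},\frac{y+a}{a}\right).$$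
   Context: A polymatroid is a pair $P=(E,r)$ with $E=E(P)$ a finite set and $r:2^E\to\mathbb{Z}$ such that $r(\emptyset)=0$, $r(A)\le r(B)$ whenever $A\subseteq B$, and $r(A)+r(B)\ge r(A\cup B)+r(A\cap B)$ for all $A,B\subseteq E$. It is a $k$-polymatroid if $r(e):=r(\{e\})\le k$ for all $e\in E$. Write $r(P)=r(E)$; $P=\emptyset$ means that the groundset is empty (the condition $U(\emptyset)=1$ is imposed for the empty polymatroid, and the recursion is required for every nonempty $P$ and every $e\in E(P)$). Deletion: $P\setminus A=(E\setminus A,\,r|_{2^{E\setminus A}})$. Contraction: $P/A=(E\setminus A,r_{P/A})$ with $r_{P/A}(X)=r(X\cup A)-r(A)$. Write $P\setminus e$, $P/e$ for $A=\{e\}$. A minor of $P$ is any polymatroid $(P/A)\setminus B$ with $A,B\subseteq E$ disjoint; minor-closed means closed under taking minors. $k$-polymatroid Tutte polynomial: $T_k(P;x,y)=\sum_{A\subseteq E}(x-1)^{r(E)-r(A)}(y-1)^{k|A|-r(A)}$. *)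

theory Defs
  imports
    "HOL-Library.FuncSet"
    "HOL-Library.Numeral_Type"
    "HOL-Library.Poly_Mapping"
    "HOL-Computational_Algebra.Polynomial_Factorial"
begin

text \<open>
  A polymatroid is a pair of a groundset and a rank function on its subsets. The rank function is
  extensional (\<^const>\<open>undefined\<close> outside the powerset of the groundset), so that equality of
  pairs is equality of polymatroids.
\<close>

type_synonym 'a polymatroid = "'a set \<times> ('a set \<Rightarrow> int)"

abbreviation ground :: "'a polymatroid \<Rightarrow> 'a set" where
  "ground P \<equiv> fst P"

abbreviation rank :: "'a polymatroid \<Rightarrow> 'a set \<Rightarrow> int" where
  "rank P \<equiv> snd P"

definition is_polymatroid :: "'a polymatroid \<Rightarrow> bool" where
  "is_polymatroid P \<longleftrightarrow>
     finite (ground P) \<and>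
     rank P \<in> Pow (ground P) \<rightarrow>\<^sub>E UNIV \<and>
     rank P {} = 0 \<and>
     (\<forall>A B. A \<subseteq> B \<and> B \<subseteq> ground P \<longrightarrow> rank P A \<le> rank P B) \<and>
     (\<forall>A B. A \<subseteq> ground P \<and> B \<subseteq> ground P \<longrightarrow>
        rank P A + rank P B \<ge> rank P (A \<union> B) + rank P (A \<inter> B))"

definition k_polymatroids :: "int \<Rightarrow> 'a polymatroid set" where
  "k_polymatroids k = {P. is_polymatroid P \<and> (\<forall>e\<in>ground P. rank P {e} \<le> k)}"

definition deletion :: "'a polymatroid \<Rightarrow> 'a set \<Rightarrow> 'a polymatroid" where
  "deletion P A = (ground P - A, restrict (rank P) (Pow (ground P - A)))"

definition contraction :: "'a polymatroid \<Rightarrow> 'a set \<Rightarrow> 'a polymatroid" where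
  "contraction P A =
     (ground P - A, \<lambda>X\<in>Pow (ground P - A). rank P (X \<union> A) - rank P A)"

definition is_minor :: "'a polymatroid \<Rightarrow> 'a polymatroid \<Rightarrow> bool" where
  "is_minor Q P \<longleftrightarrow>
     (\<exists>A B. A \<subseteq> ground P \<and> B \<subseteq> ground P \<and> A \<inter> B = {} \<and> Q = deletion (contraction P A) B)"

definition minor_closed :: "'a polymatroid set \<Rightarrow> bool" where
  "minor_closed \<P> \<longleftrightarrow> (\<forall>P\<in>\<P>. \<forall>Q. is_minor Q P \<longrightarrow> Q \<in> \<P>)"

definition total_rank :: "'a polymatroid \<Rightarrow> int" where
  "total_rank P = rank P (ground P)"

definition Delta :: "'a polymatroid \<Rightarrow> 'a \<Rightarrow> int" where
  "Delta P e = total_rank P - total_rank (deletion P {e})"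

definition rank_deficit :: "int \<Rightarrow> 'a polymatroid \<Rightarrow> 'a \<Rightarrow> int" where
  "rank_deficit k P e = k - rank P {e}"

text \<open>
  The polynomial \<open>T\<^sub>k(P; x, y)\<close> is given by its values at arguments in an arbitrary commutative
  ring. For a \<open>k\<close>-polymatroid the integers under \<^const>\<open>nat\<close> are nonnegative.
\<close>

definition tutte :: "int \<Rightarrow> 'a polymatroid \<Rightarrow> 'r::comm_ring_1 \<Rightarrow> 'r \<Rightarrow> 'r" where
  "tutte k P x y =
     (\<Sum>A\<in>Pow (ground P).
        (x - 1) ^ nat (total_rank P - rank P A) * (y - 1) ^ nat (k * int (card A) - rank P A))"

text \<open>
  \<open>\<int>[x, y, a, b]\<close>: integer-valued finitely supported functions on exponent vectors in \<open>\<nat>\<^sup>4\<close>, with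
  convolution product. The four variables are indexed by the four-element numeral type.
\<close>

type_synonym poly4 = "(4 \<Rightarrow>\<^sub>0 nat) \<Rightarrow>\<^sub>0 int"

definition indet :: "4 \<Rightarrow> poly4" where
  "indet i = Poly_Mapping.single (Poly_Mapping.single i 1) 1"

abbreviation var_x :: poly4 where "var_x \<equiv> indet 0"
abbreviation var_y :: poly4 where "var_y \<equiv> indet 1"
abbreviation var_a :: poly4 where "var_a \<equiv> indet 2"
abbreviation var_b :: poly4 where "var_b \<equiv> indet 3"

definition satisfies_recursion ::
    "int \<Rightarrow> 'a polymatroid set \<Rightarrow> ('a polymatroid \<Rightarrow> poly4) \<Rightarrow> bool" where
  "satisfies_recursion k \<P> U \<longleftrightarrow>
     (\<forall>P\<in>\<P>.
        (ground P = {} \<longrightarrow> U P = 1) \<and>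
        (\<forall>e\<in>ground P.
           U P = var_a ^ nat (k - Delta P e) * var_x ^ nat (Delta P e) * U (deletion P {e})
               + var_b ^ nat (k - rank_deficit k P e) * var_y ^ nat (rank_deficit k P e) * U (contraction P {e})))"

end

theory Submission
  imports Defs
begin

text \<open>
  Expanding \<open>T\<^sub>k\<close> and clearing denominators turns the right-hand side of the formula into
  \<open>\<Sum>A\<subseteq>E. a\<^bsup>k|E - A| - (r(E) - r(A))\<^esup> x\<^bsup>r(E) - r(A)\<^esup> b\<^bsup>r(A)\<^esup> y\<^bsup>k|A| - r(A)\<^esup>\<close>, whose exponents are
  all nonnegative because \<open>r(E) - r(A) \<le> k|E - A|\<close>. The subsets avoiding \<open>e\<close> contribute the deletion
  term of the recursion and those containing \<open>e\<close> the contraction term, so this polynomial satisfies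
  the recursion. Uniqueness holds since the recursion strictly shrinks the groundset.
\<close>

section \<open>Rank inequalities for polymatroids and \<open>k\<close>-polymatroids\<close>

lemma is_polymatroid_finite: "is_polymatroid P \<Longrightarrow> finite (ground P)"
  by (simp add: is_polymatroid_def)

lemma is_polymatroid_rank_empty: "is_polymatroid P \<Longrightarrow> rank P {} = 0"
  by (simp add: is_polymatroid_def)

lemma is_polymatroid_rank_mono:
  "is_polymatroid P \<Longrightarrow> A \<subseteq> B \<Longrightarrow> B \<subseteq> ground P \<Longrightarrow> rank P A \<le> rank P B"
  by (simp add: is_polymatroid_def)

lemma is_polymatroid_submodular:
  "is_polymatroid P \<Longrightarrow> A \<subseteq> ground P \<Longrightarrow> B \<subseteq> ground P \<Longrightarrow>
     rank P (A \<union> B) + rank P (A \<inter> B) \<le> rank P A + rank P B"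
  by (simp add: is_polymatroid_def)

lemma rank_insert_le:
  assumes "is_polymatroid P" "A \<subseteq> ground P" "e \<in> ground P"
  shows "rank P (insert e A) \<le> rank P A + rank P {e}"
proof -
  have "rank P (A \<union> {e}) + rank P (A \<inter> {e}) \<le> rank P A + rank P {e}"
    using assms by (intro is_polymatroid_submodular) auto
  moreover have "rank P {} \<le> rank P (A \<inter> {e})"
    using assms by (intro is_polymatroid_rank_mono) auto
  ultimately show ?thesis
    using is_polymatroid_rank_empty[OF assms(1)] by simp
qed

text \<open>The elements of \<open>B\<close> are added to \<open>A\<close> one at a time, and each
  raises the rank by at most \<open>k\<close>.\<close>

lemma rank_Un_le:
  assumes P: "P \<in> k_polymatroids k" and A: "A \<subseteq> ground P" and B: "B \<subseteq> ground P"
  shows "rank P (A \<union> B) \<le> rank P A + k * int (card B)"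
proof -
  have pm: "is_polymatroid P" and le: "\<And>e. e \<in> ground P \<Longrightarrow> rank P {e} \<le> k"
    using P by (auto simp: k_polymatroids_def)
  have "finite B"
    using B is_polymatroid_finite[OF pm] finite_subset by blast
  then show ?thesis
    using B
  proof (induction B rule: finite_induct)
    case empty
    then show ?case by simp
  next
    case (insert e B)
    have "rank P (insert e (A \<union> B)) \<le> rank P (A \<union> B) + rank P {e}"
      using insert.prems A by (intro rank_insert_le[OF pm]) auto
    then show ?case
      using insert le[of e] by (simp add: algebra_simps)
  qed
qed

lemma rank_le_card:
  assumes "P \<in> k_polymatroids k" "A \<subseteq> ground P"
  shows "rank P A \<le> k * int (card A)"
  using rank_Un_le[OF assms(1), of "{}" A] assms
  by (simp add: k_polymatroids_def is_polymatroid_rank_empty)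

text \<open>Going from \<open>A\<close> to the whole groundset adds the elements of the complement,
  each at cost at most \<open>k\<close>. This keeps the exponent of \<open>a\<close> in
  \<open>tutte4\<close> nonnegative.\<close>

lemma total_rank_le:
  assumes "P \<in> k_polymatroids k" "A \<subseteq> ground P"
  shows "total_rank P - rank P A \<le> k * int (card (ground P)) - k * int (card A)"
proof -
  have fin: "finite (ground P)"
    using assms(1) by (simp add: k_polymatroids_def is_polymatroid_finite)
  have "rank P (A \<union> (ground P - A)) \<le> rank P A + k * int (card (ground P - A))"
    using assms by (intro rank_Un_le) auto
  moreover have "int (card (ground P - A)) = int (card (ground P)) - int (card A)"
    using assms(2) fin by (simp add: card_Diff_subset card_mono finite_subset of_nat_diff)
  moreover have "A \<union> (ground P - A) = ground P"
    using assms(2) by blast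
  ultimately show ?thesis
    by (simp add: total_rank_def algebra_simps)
qed

lemma rank_nonneg:
  assumes "is_polymatroid P" "A \<subseteq> ground P"
  shows "0 \<le> rank P A"
  using is_polymatroid_rank_mono[OF assms(1) _ assms(2), of "{}"]
  by (simp add: is_polymatroid_rank_empty[OF assms(1)])

lemma rank_le_total_rank:
  "is_polymatroid P \<Longrightarrow> A \<subseteq> ground P \<Longrightarrow> rank P A \<le> total_rank P"
  unfolding total_rank_def by (rule is_polymatroid_rank_mono) auto

section \<open>Deletions and contractions as minors\<close>

lemma is_minor_deletion:
  assumes "is_polymatroid P" "B \<subseteq> ground P"
  shows "is_minor (deletion P B) P"
proof -
  \<comment> \<open>Minors contract first and then delete. Contracting \<open>{}\<close> only
    subtracts the rank of \<open>{}\<close>, which is 0.\<close>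
  have "deletion P B = deletion (contraction P {}) B"
    by (auto simp: deletion_def contraction_def is_polymatroid_rank_empty[OF assms(1)] fun_eq_iff)
  then show ?thesis
    using assms(2) unfolding is_minor_def by blast
qed

lemma is_minor_contraction:
  assumes "A \<subseteq> ground P"
  shows "is_minor (contraction P A) P"
proof -
  have "contraction P A = deletion (contraction P A) {}"
    by (auto simp: deletion_def contraction_def fun_eq_iff)
  then show ?thesis
    using assms unfolding is_minor_def by blast
qed

lemma minor_closed_deletion_contraction:
  assumes "minor_closed \<P>" "P \<in> \<P>" "is_polymatroid P" "e \<in> ground P"
  shows "deletion P {e} \<in> \<P>" and "contraction P {e} \<in> \<P>"
  using assms is_minor_deletion[of P "{e}"] is_minor_contraction[of "{e}" P]
  unfolding minor_closed_def by blast+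

section \<open>The expanded four-variable polynomial and its recursion\<close>

definition tutte4 :: "int \<Rightarrow> 'a polymatroid \<Rightarrow> 'r::comm_ring_1 \<Rightarrow> 'r \<Rightarrow> 'r \<Rightarrow> 'r \<Rightarrow> 'r" where
  "tutte4 k P x y a b =
     (\<Sum>A\<in>Pow (ground P).
        a ^ nat (k * int (card (ground P)) - k * int (card A) - (total_rank P - rank P A))
        * x ^ nat (total_rank P - rank P A)
        * b ^ nat (rank P A)
        * y ^ nat (k * int (card A) - rank P A))"

lemma tutte4_empty:
  assumes "is_polymatroid P" "ground P = {}"
  shows "tutte4 k P x y a b = 1"
  using assms by (simp add: tutte4_def total_rank_def is_polymatroid_rank_empty)

text \<open>Since \<open>nat\<close> sends negative integers to 0, the exponent law holds only with
  sign conditions; the rank inequalities supply them wherever exponents are split.\<close>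

lemma power_nat_add:
  fixes x :: "'r::comm_ring_1"
  assumes "i \<ge> 0" "j \<ge> 0" "l = i + j"
  shows "x ^ nat l = x ^ nat i * x ^ nat j"
  using assms by (simp add: nat_add_distrib power_add)

lemma sum_Pow_remove:
  assumes "finite E" "e \<in> E"
  shows "sum f (Pow E) = sum f (Pow (E - {e})) + (\<Sum>A\<in>Pow (E - {e}). f (insert e A))"
proof -
  have "Pow E = Pow (E - {e}) \<union> insert e ` Pow (E - {e})"
    using assms(2) by (metis Pow_insert insert_Diff)
  moreover have "inj_on (insert e) (Pow (E - {e}))"
    by (auto simp: inj_on_def)
  ultimately show ?thesis
    using assms(1) by (subst (1) \<open>Pow E = _\<close>, subst sum.union_disjoint) (auto simp: sum.reindex)
qed

text \<open>The two sides are matched summand by summand. That both minors are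
  \<open>k\<close>-polymatroids is a hypothesis, to be supplied by minor-closedness; it yields the
  rank inequalities for them.\<close>

lemma tutte4_recursion:
  fixes x y a b :: "'r::comm_ring_1"
  assumes P: "P \<in> k_polymatroids k" and e: "e \<in> ground P"
    and del: "deletion P {e} \<in> k_polymatroids k" and con: "contraction P {e} \<in> k_polymatroids k"
  shows "tutte4 k P x y a b =
      a ^ nat (k - Delta P e) * x ^ nat (Delta P e) * tutte4 k (deletion P {e}) x y a b
    + b ^ nat (k - rank_deficit k P e) * y ^ nat (rank_deficit k P e)
        * tutte4 k (contraction P {e}) x y a b"
proof -
  let ?E = "ground P" and ?F = "ground P - {e}"
  let ?D = "deletion P {e}" and ?C = "contraction P {e}"
  let ?t = "\<lambda>Q A.
    a ^ nat (k * int (card (ground Q)) - k * int (card A) - (total_rank Q - rank Q A))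
    * x ^ nat (total_rank Q - rank Q A) * b ^ nat (rank Q A) * y ^ nat (k * int (card A) - rank Q A)"
  have pm: "is_polymatroid P" "is_polymatroid ?D" "is_polymatroid ?C"
    using P del con by (auto simp: k_polymatroids_def)
  have fin: "finite ?E"
    using is_polymatroid_finite[OF pm(1)] .
  have card_F: "int (card ?F) = int (card ?E) - 1"
    using card_Suc_Diff1[OF fin e] by linarith
  have ground_D: "ground ?D = ?F" and ground_C: "ground ?C = ?F"
    by (simp_all add: deletion_def contraction_def)
  have rank_D: "rank ?D A = rank P A" if "A \<subseteq> ?F" for A
    using that by (simp add: deletion_def)
  have rank_C: "rank ?C A = rank P (insert e A) - rank P {e}" if "A \<subseteq> ?F" for A
    using that by (simp add: contraction_def)
  have total_D: "total_rank ?D = total_rank P - Delta P e"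
    by (simp add: Delta_def)
  have total_C: "total_rank ?C = total_rank P - rank P {e}"
    using e by (simp add: total_rank_def ground_C rank_C insert_absorb)
  have Delta_nonneg: "0 \<le> Delta P e"
    using rank_le_total_rank[OF pm(1), of ?F]
    by (simp add: Delta_def total_rank_def ground_D rank_D)
  \<comment> \<open>The complement of \<open>?F\<close> is the single element \<open>e\<close>, so
    the bound for \<open>total_rank P - rank P ?F\<close> is exactly \<open>k\<close>.\<close>
  have Delta_le: "Delta P e \<le> k"
    using total_rank_le[OF P, of ?F] card_F
    by (simp add: Delta_def total_rank_def ground_D rank_D algebra_simps)
  have e_nonneg: "0 \<le> rank P {e}" and e_le: "rank P {e} \<le> k"
    using rank_nonneg[OF pm(1), of "{e}"] P e by (auto simp: k_polymatroids_def)
  \<comment> \<open>Deleting \<open>e\<close> keeps the rank of \<open>A\<close>, hence the powers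
    of \<open>b\<close> and \<open>y\<close>. The total rank drops by \<open>Delta P e\<close> and
    \<open>k|E|\<close> by \<open>k\<close>, so \<open>x\<close> loses \<open>Delta P e\<close> and
    \<open>a\<close> loses \<open>k - Delta P e\<close>.\<close>
  have deletion_term:
    "?t P A = a ^ nat (k - Delta P e) * x ^ nat (Delta P e) * ?t ?D A" if A: "A \<subseteq> ?F" for A
  proof -
    have "total_rank ?D - rank ?D A \<le> k * int (card (ground ?D)) - k * int (card A)"
      using A del by (intro total_rank_le) (auto simp: ground_D)
    moreover have "rank ?D A \<le> total_rank ?D"
      using A pm(2) by (intro rank_le_total_rank) (auto simp: ground_D)
    ultimately have
      "a ^ nat (k * int (card ?E) - k * int (card A) - (total_rank P - rank P A)) =
        a ^ nat (k - Delta P e)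
        * a ^ nat (k * int (card (ground ?D)) - k * int (card A) - (total_rank ?D - rank ?D A))"
      "x ^ nat (total_rank P - rank P A) =
        x ^ nat (Delta P e) * x ^ nat (total_rank ?D - rank ?D A)"
      using Delta_nonneg Delta_le A
      by (auto intro!: power_nat_add simp: ground_D card_F total_D rank_D algebra_simps)
    then show ?thesis
      using rank_D[OF A] by (simp add: algebra_simps)
  qed
  \<comment> \<open>Contracting \<open>e\<close> lowers the rank by \<open>rank P {e}\<close>, which
    is \<open>k - rank_deficit k P e\<close>, and \<open>k|A|\<close> by \<open>k\<close>. So
    \<open>b\<close> loses \<open>rank P {e}\<close> and \<open>y\<close> loses the deficit.\<close>
  have contraction_term:
    "?t P (insert e A) =
      b ^ nat (k - rank_deficit k P e) * y ^ nat (rank_deficit k P e) * ?t ?C A"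
    if A: "A \<subseteq> ?F" for A
  proof -
    have card_insert: "int (card (insert e A)) = int (card A) + 1"
      using A fin by (subst card_insert_disjoint) (auto intro: finite_subset)
    have "rank ?C A \<le> k * int (card A)"
      using A con by (intro rank_le_card) (auto simp: ground_C)
    moreover have "0 \<le> rank ?C A"
      using A pm(3) by (intro rank_nonneg) (auto simp: ground_C)
    ultimately have
      "b ^ nat (rank P (insert e A)) = b ^ nat (k - rank_deficit k P e) * b ^ nat (rank ?C A)"
      "y ^ nat (k * int (card (insert e A)) - rank P (insert e A)) =
        y ^ nat (rank_deficit k P e) * y ^ nat (k * int (card A) - rank ?C A)"
      using e_nonneg e_le A
      by (auto intro!: power_nat_add simp: rank_C rank_deficit_def card_insert algebra_simps)
    \<comment> \<open>The powers of \<open>a\<close> and \<open>x\<close> agree: both ranks drop by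
      \<open>rank P {e}\<close>, and both cardinalities by one.\<close>
    moreover have
      "k * int (card ?E) - k * int (card (insert e A)) - (total_rank P - rank P (insert e A)) =
        k * int (card (ground ?C)) - k * int (card A) - (total_rank ?C - rank ?C A)"
      "total_rank P - rank P (insert e A) = total_rank ?C - rank ?C A"
      using A by (simp_all add: ground_C card_F card_insert total_C rank_C algebra_simps)
    ultimately show ?thesis
      by (simp only: mult_ac)
  qed
  have "tutte4 k P x y a b = (\<Sum>A\<in>Pow ?F. ?t P A) + (\<Sum>A\<in>Pow ?F. ?t P (insert e A))"
    unfolding tutte4_def by (rule sum_Pow_remove[OF fin e])
  also have "(\<Sum>A\<in>Pow ?F. ?t P A) =
      a ^ nat (k - Delta P e) * x ^ nat (Delta P e) * tutte4 k ?D x y a b"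
    unfolding tutte4_def sum_distrib_left
    by (intro sum.cong deletion_term) (auto simp: ground_D)
  also have "(\<Sum>A\<in>Pow ?F. ?t P (insert e A)) =
      b ^ nat (k - rank_deficit k P e) * y ^ nat (rank_deficit k P e) * tutte4 k ?C x y a b"
    unfolding tutte4_def sum_distrib_left
    by (intro sum.cong contraction_term) (auto simp: ground_C)
  finally show ?thesis .
qed

section \<open>Comparison with \<open>T_k\<close> in a field, and passage to the fraction
  field\<close>

lemma tutte4_eq_tutte:
  fixes x y a b :: "'r::field"
  assumes P: "P \<in> k_polymatroids k" and nz: "a \<noteq> 0" "b \<noteq> 0"
  shows "tutte4 k P x y a b =
    a ^ nat (k * int (card (ground P)) - total_rank P) * b ^ nat (total_rank P)
    * tutte k P ((x + b) / b) ((y + a) / a)"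
proof -
  have pm: "is_polymatroid P"
    using P by (simp add: k_polymatroids_def)
  \<comment> \<open>The arguments of \<open>tutte\<close> are chosen so that its two bases become
    \<open>x / b\<close> and \<open>y / a\<close>.\<close>
  have shift: "(x + b) / b - 1 = x / b" "(y + a) / a - 1 = y / a"
    using nz by (simp_all add: field_simps)
  show ?thesis
    unfolding tutte4_def tutte_def sum_distrib_left shift
  proof (intro sum.cong refl)
    fix A assume "A \<in> Pow (ground P)"
    then have A: "A \<subseteq> ground P" by simp
    note bounds = total_rank_le[OF P A] rank_le_card[OF P A] rank_nonneg[OF pm A]
      rank_le_total_rank[OF pm A]
    \<comment> \<open>Each prefactor splits in two: one part cancels the denominator of
      \<open>y / a\<close> (below, of \<open>x / b\<close>), and the other is the power of
      \<open>a\<close> (below, of \<open>b\<close>) in the summand of \<open>tutte4\<close>.\<close>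
    have "a ^ nat (k * int (card (ground P)) - total_rank P) =
        a ^ nat (k * int (card (ground P)) - k * int (card A) - (total_rank P - rank P A))
        * a ^ nat (k * int (card A) - rank P A)"
      using bounds by (intro power_nat_add) auto
    moreover have "b ^ nat (total_rank P) = b ^ nat (rank P A) * b ^ nat (total_rank P - rank P A)"
      using bounds by (intro power_nat_add) auto
    ultimately show
      "a ^ nat (k * int (card (ground P)) - k * int (card A) - (total_rank P - rank P A))
        * x ^ nat (total_rank P - rank P A) * b ^ nat (rank P A)
        * y ^ nat (k * int (card A) - rank P A) =
      a ^ nat (k * int (card (ground P)) - total_rank P) * b ^ nat (total_rank P)
        * ((x / b) ^ nat (total_rank P - rank P A) * (y / a) ^ nat (k * int (card A) - rank P A))"
      using nz by (simp add: power_divide)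
  qed
qed

lemma to_fract_power: "to_fract (p ^ n) = to_fract p ^ n"
  by (induction n) simp_all

lemma to_fract_sum: "to_fract (sum f A) = (\<Sum>i\<in>A. to_fract (f i))"
  by (induction A rule: infinite_finite_induct) simp_all

text \<open>\<open>tutte4\<close> uses only ring operations with natural exponents, so the embedding
  into the fraction field passes through it. This is why it is defined over any commutative
  ring.\<close>

lemma to_fract_tutte4:
  "to_fract (tutte4 k P x y a b) =
     tutte4 k P (to_fract x) (to_fract y) (to_fract a) (to_fract b)"
  by (simp add: tutte4_def to_fract_power to_fract_sum)

lemma indet_nonzero: "indet i \<noteq> 0"
  by (simp add: indet_def)

section \<open>Uniqueness, then existence and the formula\<close>

lemma satisfies_recursion_unique:
  assumes minor: "minor_closed \<P>" and pm: "\<And>P. P \<in> \<P> \<Longrightarrow> is_polymatroid P"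
    and U: "satisfies_recursion k \<P> U" and V: "satisfies_recursion k \<P> V"
    and "P \<in> \<P>"
  shows "U P = V P"
  using \<open>P \<in> \<P>\<close>
proof (induction "card (ground P)" arbitrary: P rule: less_induct)
  case less
  show ?case
  proof (cases "ground P = {}")
    case True
    then show ?thesis
      using U V less.prems by (simp add: satisfies_recursion_def)
  next
    case False
    \<comment> \<open>One element suffices: the recursion at \<open>e\<close> determines the value
      at \<open>P\<close> from two minors on the smaller groundset
      \<open>ground P - {e}\<close>.\<close>
    then obtain e where e: "e \<in> ground P" by blast
    have "deletion P {e} \<in> \<P>" "contraction P {e} \<in> \<P>"
      using minor_closed_deletion_contraction[OF minor less.prems pm[OF less.prems] e] by this
    moreover have "card (ground P - {e}) < card (ground P)"
      using e is_polymatroid_finite[OF pm[OF less.prems]] by (intro psubset_card_mono) auto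
    ultimately have "U (deletion P {e}) = V (deletion P {e})"
      "U (contraction P {e}) = V (contraction P {e})"
      by (auto intro!: less.hyps simp: deletion_def contraction_def)
    moreover have "W P = var_a ^ nat (k - Delta P e) * var_x ^ nat (Delta P e) * W (deletion P {e})
        + var_b ^ nat (k - rank_deficit k P e) * var_y ^ nat (rank_deficit k P e)
          * W (contraction P {e})" if "satisfies_recursion k \<P> W" for W
      using that less.prems e unfolding satisfies_recursion_def by blast
    ultimately show ?thesis
      using U V by metis
  qed
qed

theorem theorem3p7:
  fixes k :: int and \<P> :: "'a polymatroid set"
  assumes "k \<ge> 1"
    and "\<P> \<subseteq> k_polymatroids k"
    and "minor_closed \<P>"
  shows "(\<exists>!U. U \<in> \<P> \<rightarrow>\<^sub>E UNIV \<and> satisfies_recursion k \<P> U) \<and>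
    (\<forall>U. U \<in> \<P> \<rightarrow>\<^sub>E UNIV \<and> satisfies_recursion k \<P> U \<longrightarrow>
      (\<forall>P\<in>\<P>. to_fract (U P) =
          to_fract var_a ^ nat (k * int (card (ground P)) - total_rank P)
          * to_fract var_b ^ nat (total_rank P)
          * tutte k P
              ((to_fract var_x + to_fract var_b) / to_fract var_b)
              ((to_fract var_y + to_fract var_a) / to_fract var_a)))"
proof -
  \<comment> \<open>Restricting to \<open>\<P>\<close> makes \<open>V\<close> extensional, so that
    uniqueness can be stated as equality of functions.\<close>
  define V :: "'a polymatroid \<Rightarrow> poly4"
    where "V = (\<lambda>P\<in>\<P>. tutte4 k P var_x var_y var_a var_b)"
  have pm: "is_polymatroid P" if "P \<in> \<P>" for P
    using that assms(2) by (auto simp: k_polymatroids_def)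
  have V_ext: "V \<in> \<P> \<rightarrow>\<^sub>E UNIV"
    by (simp add: V_def)
  have V_rec: "satisfies_recursion k \<P> V"
    unfolding satisfies_recursion_def
  proof (intro ballI conjI impI)
    fix P assume "P \<in> \<P>" "ground P = {}"
    then show "V P = 1"
      by (simp add: V_def tutte4_empty pm)
  next
    fix P e assume P: "P \<in> \<P>" and e: "e \<in> ground P"
    have minors: "deletion P {e} \<in> \<P>" "contraction P {e} \<in> \<P>"
      using minor_closed_deletion_contraction[OF assms(3) P pm[OF P] e] by this
    show "V P = var_a ^ nat (k - Delta P e) * var_x ^ nat (Delta P e) * V (deletion P {e})
        + var_b ^ nat (k - rank_deficit k P e) * var_y ^ nat (rank_deficit k P e)
          * V (contraction P {e})"
      \<comment> \<open>Both minors lie in \<open>\<P>\<close>, so all three values of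
        \<open>V\<close> are genuine values of \<open>tutte4\<close> rather than
        \<open>undefined\<close>.\<close>
      unfolding V_def restrict_apply'[OF P] minors[THEN restrict_apply']
      using P minors by (intro tutte4_recursion e subsetD[OF assms(2)])
  qed
  have unique: "U P = V P" if "satisfies_recursion k \<P> U" "P \<in> \<P>" for U P
    using satisfies_recursion_unique[OF assms(3) pm that(1) V_rec that(2)] .
  have "\<exists>!U. U \<in> \<P> \<rightarrow>\<^sub>E UNIV \<and> satisfies_recursion k \<P> U"
  proof (intro ex1I conjI)
    fix U assume "U \<in> \<P> \<rightarrow>\<^sub>E UNIV \<and> satisfies_recursion k \<P> U"
    then show "U = V"
      by (intro PiE_ext[OF _ V_ext] unique) auto
  qed (fact V_ext V_rec)+
  \<comment> \<open>Every solution agrees with \<open>V\<close> on \<open>\<P>\<close>, so the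
    formula is checked for \<open>V\<close> alone; the denominators are nonzero because
    indeterminates are.\<close>
  moreover have "to_fract (V P) =
      to_fract var_a ^ nat (k * int (card (ground P)) - total_rank P)
      * to_fract var_b ^ nat (total_rank P)
      * tutte k P
          ((to_fract var_x + to_fract var_b) / to_fract var_b)
          ((to_fract var_y + to_fract var_a) / to_fract var_a)" if P: "P \<in> \<P>" for P
  proof -
    have "P \<in> k_polymatroids k"
      using P assms(2) by blast
    then show ?thesis
      using P by (simp add: V_def to_fract_tutte4 tutte4_eq_tutte indet_nonzero)
  qed
  ultimately show ?thesis
    by (simp add: unique)
qed

end
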